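(* Consider the `N'-system with rates $\lambda_1,\lambda_2,\mu_1,\mu_2>0$ satisfying $\lambda_2<\mu_2$ and $\lambda_1+\lambda_2<\mu_1+\mu_2$. Let $N_i^r$ and $N_i^q$ ($i=1,2$) be the numbers of type $i$ customers in the system in steady state under the Redundancy Service policy and the FCFS-ALIS policy, respectively. Then the total number in system under Redundancy Service is stochastically greater than the total number in system under FCFS-ALIS minus $1$: $$N_1^r+N_2^r\ \ge_{ST}\ N_1^q+N_2^q-1 .$$
   Context: `N'-system: there are two servers and two customer types. Type $i$ customers arrive in a Poisson stream of rate $\lambda_i$, $i=1,2$, the streams being independent. Type 1 customers can be served by either server; type 2 customers can be served only by server 2. Service by server $j$ is exponential with rate $\mu_j$, $j=1,2$ (for any customer type), independent of everything else. FCFS-ALIS policy: an arriving customer is immediately assigned to the compatible server that has been idle longest, if some compatible server is idle; otherwise it joins a single queue. A server completing a service starts serving the longest waiting compatible customer if there is one, otherwise it becomes idle. Redundancy Service policy: each server has its own FCFS queue. An arriving customer places a copy in the queue of every compatible server; several servers may process copies of the same customer simultaneously; the customer and all its copies leave when the first copy completes service. Numbers in system count customers waiting and in service (a customer is counted once regardless of the number of copies). $X\ge_{ST}Y$ means $P(X\ge x)\ge P(Y\ge x)$ for all real $x$. *)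

theory Defs
  imports "HOL-Probability.Probability"
begin

datatype ctype = Type1 | Type2

datatype server = Server1 | Server2

fun compatible :: "ctype \<Rightarrow> server \<Rightarrow> bool" where
  "compatible Type1 j = True"
| "compatible Type2 j = (j = Server2)"

datatype event = Arrival ctype | Completion server

fun event_rate :: "(ctype \<Rightarrow> real) \<Rightarrow> (server \<Rightarrow> real) \<Rightarrow> event \<Rightarrow> real" where
  "event_rate lam mu (Arrival i) = lam i"
| "event_rate lam mu (Completion j) = mu j"

lemma UNIV_event:
  "(UNIV :: event set) =
    {Arrival Type1, Arrival Type2, Completion Server1, Completion Server2}"
proof -
  have "e \<in> {Arrival Type1, Arrival Type2, Completion Server1, Completion Server2}" for e
  proof (cases e)
    case (Arrival i)
    then show ?thesis by (cases i) auto
  next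
    case (Completion j)
    then show ?thesis by (cases j) auto
  qed
  then show ?thesis by auto
qed

instance event :: finite
  by standard (simp add: UNIV_event)

text \<open>A Markovian system is given by its events and a step function: \<open>step e x\<close> is the state
  reached from \<open>x\<close> when \<open>e\<close> happens, and \<open>None\<close> if \<open>e\<close> cannot happen in \<open>x\<close> (no completion at an
  idle server). While enabled, an event happens at its exponential rate.\<close>

definition jump_rate :: "('e::finite \<Rightarrow> real) \<Rightarrow> ('e \<Rightarrow> 's \<Rightarrow> 's option) \<Rightarrow> 's \<Rightarrow> 's \<Rightarrow> real" where
  "jump_rate R step x y = (\<Sum>e | step e x = Some y. R e)"

definition reachable :: "('s \<Rightarrow> 's \<Rightarrow> real) \<Rightarrow> 's \<Rightarrow> 's set" where
  "reachable q s0 = {s. (s0, s) \<in> {(x, y). q x y > 0}\<^sup>*}"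

text \<open>The stationary distribution, on the states that can be reached from \<open>s0\<close>, of the
  continuous-time Markov chain with jump rates \<open>q\<close>: flow into each state equals flow out of it.
  The total jump rates of the systems below are bounded, so these chains do not explode and the
  balance equations express invariance under the transition semigroup. Restricting to reachable
  states discards meaningless ones (e.g. a server that is both busy and listed as idle).
  A jump from a state to itself would contribute equally to both sides.\<close>

definition steady_state :: "('s \<Rightarrow> 's \<Rightarrow> real) \<Rightarrow> 's \<Rightarrow> 's pmf \<Rightarrow> bool" where
  "steady_state q s0 p \<longleftrightarrow>
    set_pmf p \<subseteq> reachable q s0 \<and>
    (\<forall>y. ((\<lambda>x. pmf p x * q x y) has_sum (pmf p y * (\<Sum>\<^sub>\<infinity>z. q y z))) UNIV)"

text \<open>FCFS-ALIS. \<open>waiting\<close> lists the types of the waiting customers in order of arrival,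
  \<open>serving j\<close> is the type of the customer in service at server \<open>j\<close>, and \<open>idle\<close> lists the idle
  servers, the longest idle one first. As compatibility depends only on the type, the longest
  waiting compatible customer is the first one of its type, which is what \<open>remove1\<close> removes.\<close>

record fcfs_state =
  waiting :: "ctype list"
  serving :: "server \<Rightarrow> ctype option"
  idle :: "server list"

fun fcfs_step :: "event \<Rightarrow> fcfs_state \<Rightarrow> fcfs_state option" where
  "fcfs_step (Arrival i) s =
    Some (case find (\<lambda>j. compatible i j) (idle s) of
      Some j \<Rightarrow> s\<lparr>serving := (serving s)(j := Some i), idle := remove1 j (idle s)\<rparr>
    | None \<Rightarrow> s\<lparr>waiting := waiting s @ [i]\<rparr>)"
| "fcfs_step (Completion j) s =
    (if serving s j = None then None
     else Some (case find (\<lambda>i. compatible i j) (waiting s) of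
       Some i \<Rightarrow> s\<lparr>waiting := remove1 i (waiting s), serving := (serving s)(j := Some i)\<rparr>
     | None \<Rightarrow> s\<lparr>serving := (serving s)(j := None), idle := idle s @ [j]\<rparr>))"

text \<open>The order of the two initially idle servers is immaterial, since the empty states with
  either order can be reached from each other.\<close>

definition fcfs_empty :: fcfs_state where
  "fcfs_empty = \<lparr>waiting = [], serving = (\<lambda>_. None), idle = [Server1, Server2]\<rparr>"

definition fcfs_number :: "ctype \<Rightarrow> fcfs_state \<Rightarrow> nat" where
  "fcfs_number i s = count_list (waiting s) i + card {j. serving s j = Some i}"

text \<open>Redundancy Service. A state lists the types of all customers in the system in order of
  arrival. The FCFS queue of server \<open>j\<close> is the sublist of the customers compatible with \<open>j\<close>; the
  server works on its head, whose departure removes all copies, i.e. the customer from the list.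
  The first compatible customer is again the first one of its type.\<close>

definition copy_queue :: "server \<Rightarrow> ctype list \<Rightarrow> ctype list" where
  "copy_queue j s = filter (\<lambda>i. compatible i j) s"

fun red_step :: "event \<Rightarrow> ctype list \<Rightarrow> ctype list option" where
  "red_step (Arrival i) s = Some (s @ [i])"
| "red_step (Completion j) s =
    (case copy_queue j s of [] \<Rightarrow> None | i # _ \<Rightarrow> Some (remove1 i s))"

definition red_number :: "ctype \<Rightarrow> ctype list \<Rightarrow> nat" where
  "red_number i s = count_list s i"

definition fcfs_steady_state ::
  "(ctype \<Rightarrow> real) \<Rightarrow> (server \<Rightarrow> real) \<Rightarrow> fcfs_state pmf \<Rightarrow> bool" where
  "fcfs_steady_state lam mu =
    steady_state (jump_rate (event_rate lam mu) fcfs_step) fcfs_empty"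

definition red_steady_state ::
  "(ctype \<Rightarrow> real) \<Rightarrow> (server \<Rightarrow> real) \<Rightarrow> ctype list pmf \<Rightarrow> bool" where
  "red_steady_state lam mu =
    steady_state (jump_rate (event_rate lam mu) red_step) []"

definition st_ge :: "real pmf \<Rightarrow> real pmf \<Rightarrow> bool" (infix "\<ge>\<^sub>S\<^sub>T" 50) where
  "X \<ge>\<^sub>S\<^sub>T Y \<longleftrightarrow> (\<forall>x. measure_pmf.prob X {x..} \<ge> measure_pmf.prob Y {x..})"

end

theory Submission
  imports Defs
begin

text \<open>Both stationary laws have product form. After uniformization, an invariant distribution of an
  irreducible chain is determined up to scaling, so it suffices to exhibit weights satisfying the
  balance equations. FCFS-ALIS is first lumped by forgetting which types are in service; when both
  servers are busy, the weight of the list of waiting customers is its weight as a Redundancy Service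
  state. Let \<open>h n\<close> be the total weight of the Redundancy Service states with \<open>n\<close> customers. Up to a
  constant, \<open>N\<^sup>q - 1\<close> has weight \<open>\<mu>/\<lambda>\<^sub>1 h n - \<lambda>\<^sub>2/\<lambda>\<^sub>1 h (n - 1)\<close> at \<open>n \<ge> 0\<close>, where
  \<open>\<mu> = \<mu>\<^sub>1 + \<mu>\<^sub>2\<close> and \<open>h (-1) = \<mu>\<^sub>2/(\<lambda>\<^sub>1 + \<lambda>\<^sub>2)\<close>. Its ratio to \<open>h n\<close> decreases because \<open>h\<close> is
  log-concave, and a decreasing likelihood ratio implies stochastic dominance.\<close>

section \<open>Invariant weights of Markov chains\<close>

text \<open>Moves the balance equations into nonnegative integrals, where Tonelli and monotonicity
  apply even to weights of infinite mass.\<close>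

lemma has_sum_imp_nn_integral_count_space:
  fixes f :: "'a \<Rightarrow> real"
  assumes "(f has_sum S) A" and "\<And>x. x \<in> A \<Longrightarrow> 0 \<le> f x"
  shows "(\<integral>\<^sup>+x. ennreal (f x) \<partial>count_space A) = ennreal S"
proof -
  have abs: "Infinite_Set_Sum.abs_summable_on f A"
    using assms(1) has_sum_imp_summable summable_on_iff_abs_summable_on_real
      abs_summable_equivalent by blast
  then have "infsetsum f A = S"
    using assms(1) infsetsum_infsum infsumI by metis
  moreover have "integrable (count_space A) f"
    using abs by (simp add: Infinite_Set_Sum.abs_summable_on_def)
  ultimately show ?thesis
    using assms(2) by (subst nn_integral_eq_integral)
      (auto simp: infsetsum_def AE_count_space)
qed

text \<open>The difference has integral 0, and counting measure has no nonempty null sets.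
  Finiteness permits the subtraction in \<open>ennreal\<close>.\<close>

lemma nn_integral_count_space_eq_imp_eq:
  fixes f g :: "'a \<Rightarrow> ennreal"
  assumes le: "\<And>x. f x \<le> g x"
    and eq: "(\<integral>\<^sup>+x. f x \<partial>count_space UNIV) = (\<integral>\<^sup>+x. g x \<partial>count_space UNIV)"
    and fin: "(\<integral>\<^sup>+x. g x \<partial>count_space UNIV) < \<infinity>"
  shows "f x = g x"
proof -
  have "(\<integral>\<^sup>+x. g x - f x \<partial>count_space UNIV) = 0"
    using assms by (subst nn_integral_diff) auto
  then have "g x - f x = 0"
    by (subst (asm) nn_integral_0_iff_AE) (auto simp: AE_count_space)
  then show ?thesis
    using le[of x] by (metis antisym diff_eq_0_iff_ennreal less_le_not_le linear top.not_eq_extremum)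
qed

text \<open>Each row of \<open>K\<close> has mass 1, so the kernel preserves total mass.\<close>

lemma nn_integral_kernel_count_space:
  fixes K :: "'s \<Rightarrow> 's pmf" and f :: "'s \<Rightarrow> ennreal"
  shows "(\<integral>\<^sup>+y. (\<integral>\<^sup>+x. f x * pmf (K x) y \<partial>count_space UNIV) \<partial>count_space UNIV)
    = (\<integral>\<^sup>+x. f x \<partial>count_space UNIV)"
proof -
  have "(\<integral>\<^sup>+y. (\<integral>\<^sup>+x. f x * pmf (K x) y \<partial>count_space UNIV) \<partial>count_space UNIV)
      = (\<integral>\<^sup>+x. (\<integral>\<^sup>+y. f x * pmf (K x) y \<partial>count_space UNIV) \<partial>count_space UNIV)"
    using nn_integral_fst_count_space[of "\<lambda>(x, y). f x * ennreal (pmf (K x) y)"]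
      nn_integral_snd_count_space[of "\<lambda>(x, y). f x * ennreal (pmf (K x) y)"] by simp
  also have "\<dots> = (\<integral>\<^sup>+x. f x \<partial>count_space UNIV)"
    by (simp add: nn_integral_cmult nn_integral_pmf)
  finally show ?thesis .
qed

definition invariant :: "('s \<Rightarrow> 's pmf) \<Rightarrow> ('s \<Rightarrow> real) \<Rightarrow> bool" where
  "invariant K w \<longleftrightarrow>
    (\<forall>y. (\<integral>\<^sup>+x. ennreal (w x) * ennreal (pmf (K x) y) \<partial>count_space UNIV) = ennreal (w y))"

lemma invariant_pmf_iff: "invariant K (pmf p) \<longleftrightarrow> bind_pmf p K = p"
proof -
  have "(\<integral>\<^sup>+x. ennreal (pmf p x) * ennreal (pmf (K x) y) \<partial>count_space UNIV)
      = ennreal (pmf (bind_pmf p K) y)" for y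
    by (simp add: ennreal_pmf_bind nn_integral_measure_pmf)
  then show ?thesis
    by (simp add: invariant_def pmf_eq_iff)
qed

text \<open>The minimum \<open>m\<close> of two invariant weights satisfies \<open>m K \<le> m\<close>; as \<open>m\<close> is summable and \<open>K\<close>
  preserves the total mass, \<open>m\<close> is invariant. Where \<open>m\<close> agrees with an invariant weight, it thus
  also does so at all predecessors.\<close>

theorem invariant_unique_up_to_scaling:
  fixes K :: "'s \<Rightarrow> 's pmf" and p :: "'s pmf" and w :: "'s \<Rightarrow> real"
  assumes inv_p: "invariant K (pmf p)" and inv_w: "invariant K w"
    and nonneg: "\<And>x. 0 \<le> w x" and pos: "0 < w s0"
    and reach: "\<And>x. (x, s0) \<in> {(x, y). 0 < pmf (K x) y}\<^sup>*"
  obtains c where "0 \<le> c" and "\<And>x. pmf p x = c * w x"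
proof -
  \<comment> \<open>Scaled so that \<open>c * w\<close> agrees with \<open>p\<close> at
    \<open>s0\<close>, where the backward propagation starts.\<close>
  define c where "c = pmf p s0 / w s0"
  have c: "0 \<le> c" "c * w s0 = pmf p s0"
    using pos by (auto simp: c_def)
  define v where "v x = c * w x" for x
  define m where "m x = min (pmf p x) (v x)" for x
  define step where "step f y = (\<integral>\<^sup>+x. ennreal (f x) * ennreal (pmf (K x) y) \<partial>count_space UNIV)"
    for f :: "'s \<Rightarrow> real" and y
  have step_p: "step (pmf p) y = ennreal (pmf p y)" for y
    using inv_p by (simp add: step_def invariant_def)
  have step_v: "step v y = ennreal (v y)" for y
  proof -
    have "step v y = (\<integral>\<^sup>+x. ennreal c * (ennreal (w x) * ennreal (pmf (K x) y)) \<partial>count_space UNIV)"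
      using c nonneg by (simp add: step_def v_def ennreal_mult mult.assoc)
    also have "\<dots> = ennreal (v y)"
      using c nonneg inv_w by (simp add: nn_integral_cmult invariant_def v_def ennreal_mult)
    finally show ?thesis .
  qed
  have step_mono: "step f y \<le> step g y" if "\<And>x. f x \<le> g x" for f g y
    unfolding step_def using that by (intro nn_integral_mono mult_right_mono ennreal_leI) auto
  have step_m: "step m y = ennreal (m y)" for y
  proof (rule nn_integral_count_space_eq_imp_eq[where f = "step m"])
    show "step m x \<le> ennreal (m x)" for x
      using step_mono[of m "pmf p" x] step_mono[of m v x]
      by (auto simp: step_p step_v m_def min_def)
    show "(\<integral>\<^sup>+x. step m x \<partial>count_space UNIV) = (\<integral>\<^sup>+x. ennreal (m x) \<partial>count_space UNIV)"
      by (simp add: step_def nn_integral_kernel_count_space)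
    have "(\<integral>\<^sup>+x. ennreal (m x) \<partial>count_space UNIV) \<le> (\<integral>\<^sup>+x. ennreal (pmf p x) \<partial>count_space UNIV)"
      by (intro nn_integral_mono ennreal_leI) (simp add: m_def)
    also have "\<dots> = 1"
      by (simp add: nn_integral_pmf)
    finally show "(\<integral>\<^sup>+x. ennreal (m x) \<partial>count_space UNIV) < \<infinity>"
      by (simp add: le_less_trans)
  qed
  \<comment> \<open>Used with \<open>g\<close> equal to \<open>pmf p\<close> and to
    \<open>v\<close>. The sums \<open>step m y\<close> and \<open>step g y\<close> are equal and
    finite, the first dominated term by term, so the terms at \<open>x\<close> agree and the factor
    \<open>pmf (K x) y\<close> cancels.\<close>
  have predecessor: "g x = m x" if g: "\<And>x. m x \<le> g x" "\<And>x. step g x = ennreal (g x)"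
    and eq: "g y = m y" and xy: "0 < pmf (K x) y" and g0: "0 \<le> m x" for g x y
  proof -
    have "ennreal (m x) * ennreal (pmf (K x) y) = ennreal (g x) * ennreal (pmf (K x) y)"
    proof (rule nn_integral_count_space_eq_imp_eq[where x = x])
      show "ennreal (m x) * ennreal (pmf (K x) y) \<le> ennreal (g x) * ennreal (pmf (K x) y)" for x
        using g(1) by (intro mult_right_mono ennreal_leI) auto
      show "(\<integral>\<^sup>+x. ennreal (m x) * ennreal (pmf (K x) y) \<partial>count_space UNIV) =
          (\<integral>\<^sup>+x. ennreal (g x) * ennreal (pmf (K x) y) \<partial>count_space UNIV)"
        using step_m[of y] g(2)[of y] eq by (simp add: step_def)
      show "(\<integral>\<^sup>+x. ennreal (g x) * ennreal (pmf (K x) y) \<partial>count_space UNIV) < \<infinity>"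
        using g(2)[of y] by (simp add: step_def)
    qed
    moreover have "0 \<le> g x"
      using g(1)[of x] g0 by simp
    ultimately show ?thesis
      using xy g0 by (metis ennreal_inj ennreal_mult mult_right_cancel less_irrefl mult_nonneg_nonneg pmf_nonneg)
  qed
  have m0: "0 \<le> m x" for x
    using c nonneg by (simp add: m_def v_def)
  have "pmf p x = m x \<and> v x = m x" for x
    using reach[of x]
  proof (induction rule: converse_rtrancl_induct)
    case base
    show ?case
      using c by (simp add: m_def v_def)
  next
    case (step x y)
    then have "0 < pmf (K x) y"
      by simp
    with step.IH show ?case
      by (intro conjI predecessor[of _ y x] m0 step_p step_v) (auto simp: m_def)
  qed
  then have "pmf p x = c * w x" for x
    by (simp add: v_def)
  with c(1) show thesis
    by (rule that)
qed

section \<open>Uniformization and lumping of jump chains\<close>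

definition uniformized :: "('e::finite \<Rightarrow> real) \<Rightarrow> ('e \<Rightarrow> 's \<Rightarrow> 's option) \<Rightarrow> 's \<Rightarrow> 's pmf" where
  "uniformized R step x =
    map_pmf (\<lambda>e. case step e x of None \<Rightarrow> x | Some y \<Rightarrow> y) (embed_pmf (\<lambda>e. R e / sum R UNIV))"

definition balanced :: "('s \<Rightarrow> 's \<Rightarrow> real) \<Rightarrow> ('s \<Rightarrow> real) \<Rightarrow> bool" where
  "balanced q w \<longleftrightarrow> (\<forall>y. ((\<lambda>x. w x * q x y) has_sum (w y * (\<Sum>\<^sub>\<infinity>z. q y z))) UNIV)"

locale jump_chain =
  fixes R :: "'e::finite \<Rightarrow> real" and step :: "'e \<Rightarrow> 's \<Rightarrow> 's option"
  assumes rate_pos: "0 < R e"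
begin

lemma total_rate_pos: "0 < sum R UNIV"
  using rate_pos by (simp add: sum_pos)

lemma pmf_event: "pmf (embed_pmf (\<lambda>e. R e / sum R UNIV)) e = R e / sum R UNIV"
proof (rule pmf_embed_pmf)
  show "0 \<le> R e / sum R UNIV" for e
    using rate_pos[of e] total_rate_pos by simp
  have "(\<integral>\<^sup>+e. ennreal (R e / sum R UNIV) \<partial>count_space UNIV) = ennreal (\<Sum>e\<in>UNIV. R e / sum R UNIV)"
    using rate_pos total_rate_pos
    by (simp add: nn_integral_count_space_finite less_imp_le flip: sum_ennreal)
  also have "\<dots> = 1"
    using total_rate_pos by (simp flip: sum_divide_distrib)
  finally show "(\<integral>\<^sup>+e. ennreal (R e / sum R UNIV) \<partial>count_space UNIV) = 1" .
qed

lemma pmf_uniformized: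
  "pmf (uniformized R step x) y =
    (jump_rate R step x y + (if x = y then \<Sum>e | step e x = None. R e else 0)) / sum R UNIV"
proof -
  have "pmf (uniformized R step x) y
      = (\<Sum>e | (case step e x of None \<Rightarrow> x | Some y \<Rightarrow> y) = y. R e) / sum R UNIV"
    by (simp add: uniformized_def pmf_map vimage_def measure_measure_pmf_finite pmf_event
        sum_divide_distrib)
  also have "{e. (case step e x of None \<Rightarrow> x | Some y \<Rightarrow> y) = y}
      = {e. step e x = Some y} \<union> {e. x = y \<and> step e x = None}"
    by (rule set_eqI, rename_tac e, case_tac "step e x") auto
  also have "sum R \<dots> = jump_rate R step x y + (if x = y then \<Sum>e | step e x = None. R e else 0)"
    by (subst sum.union_disjoint) (auto simp: jump_rate_def)
  finally show ?thesis .
qed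

lemma uniformized_pos: "step e x = Some y \<Longrightarrow> 0 < pmf (uniformized R step x) y"
proof -
  assume "step e x = Some y"
  then have "R e \<le> jump_rate R step x y"
    unfolding jump_rate_def using rate_pos by (intro member_le_sum) (auto simp: less_imp_le)
  moreover have "0 \<le> (\<Sum>e | step e x = None. R e)"
    using rate_pos by (intro sum_nonneg) (auto simp: less_imp_le)
  ultimately show ?thesis
    using rate_pos[of e] total_rate_pos by (auto simp: pmf_uniformized intro!: divide_pos_pos)
qed

lemma infsum_jump_rate: "(\<Sum>\<^sub>\<infinity>z. jump_rate R step y z) = (\<Sum>e | step e y \<noteq> None. R e)"
proof -
  define T where "T = (\<lambda>e. the (step e y)) ` {e. step e y \<noteq> None}"
  have "(\<Sum>\<^sub>\<infinity>z. jump_rate R step y z) = (\<Sum>z\<in>T. jump_rate R step y z)"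
  proof (rule infsumI, rule has_sum_finite_neutralI)
    show "jump_rate R step y z = 0" if "z \<in> UNIV - T" for z
    proof -
      have "{e. step e y = Some z} = {}"
        using that by (force simp: T_def)
      then show ?thesis
        by (simp add: jump_rate_def)
    qed
  qed (auto simp: T_def)
  also have "\<dots> = (\<Sum>z\<in>T. \<Sum>e | e \<in> {e. step e y \<noteq> None} \<and> the (step e y) = z. R e)"
    unfolding jump_rate_def by (intro sum.cong refl) auto
  also have "\<dots> = (\<Sum>e | step e y \<noteq> None. R e)"
    by (rule sum.group) (auto simp: T_def)
  finally show ?thesis .
qed

text \<open>The events disabled at \<open>y\<close> are self-loops of the uniformized chain and add
  the same amount to both sides. The outflow becomes \<open>w y\<close> times the total rate of all
  events, which is divided out.\<close>

lemma balanced_imp_invariant: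
  assumes bal: "balanced (jump_rate R step) w" and nonneg: "\<And>x. 0 \<le> w x"
  shows "invariant (uniformized R step) w"
  unfolding invariant_def
proof
  fix y
  let ?q = "jump_rate R step" and ?I = "\<Sum>e | step e y = None. R e"
  have q0: "0 \<le> ?q x z" for x z
    unfolding jump_rate_def using rate_pos by (intro sum_nonneg) (auto simp: less_imp_le)
  have "((\<lambda>x. w x * ?q x y) has_sum (w y * (\<Sum>e | step e y \<noteq> None. R e))) UNIV"
    using bal by (simp add: balanced_def infsum_jump_rate)
  moreover have "((\<lambda>x. if x = y then w y * ?I else 0) has_sum (w y * ?I)) UNIV"
    by (rule has_sum_finite_neutralI[of "{y}"]) auto
  ultimately have "((\<lambda>x. w x * ?q x y + (if x = y then w y * ?I else 0)) has_sum
      (w y * (\<Sum>e | step e y \<noteq> None. R e) + w y * ?I)) UNIV"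
    by (rule has_sum_add)
  from has_sum_cmult_left[OF this, of "1 / sum R UNIV"]
  have "((\<lambda>x. w x * pmf (uniformized R step x) y) has_sum
      ((w y * (\<Sum>e | step e y \<noteq> None. R e) + w y * ?I) * (1 / sum R UNIV))) UNIV"
    by (rule back_subst[of "\<lambda>f. (f has_sum _) UNIV"])
      (auto simp: fun_eq_iff pmf_uniformized field_simps)
  also have "(w y * (\<Sum>e | step e y \<noteq> None. R e) + w y * ?I) * (1 / sum R UNIV) = w y"
  proof -
    have "(\<Sum>e | step e y \<noteq> None. R e) + ?I = sum R UNIV"
      by (subst sum.union_disjoint[symmetric]) (auto intro!: sum.cong)
    then show ?thesis
      using total_rate_pos by (simp flip: distrib_left)
  qed
  finally show "(\<integral>\<^sup>+x. ennreal (w x) * ennreal (pmf (uniformized R step x) y) \<partial>count_space UNIV)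
      = ennreal (w y)"
    using nonneg
    by (subst has_sum_imp_nn_integral_count_space[symmetric, where f = "\<lambda>x. w x * pmf (uniformized R step x) y"])
      (auto simp: ennreal_mult)
qed

text \<open>Summing over events before source states reduces balance to one finite preimage per
  event.\<close>

lemma balancedI:
  assumes fin: "\<And>e y. finite {x. step e x = Some y}"
    and flow: "\<And>y. (\<Sum>e\<in>UNIV. R e * (\<Sum>x | step e x = Some y. w x))
      = w y * (\<Sum>e | step e y \<noteq> None. R e)"
  shows "balanced (jump_rate R step) w"
  unfolding balanced_def infsum_jump_rate
proof
  fix y
  let ?P = "\<Union>e. {x. step e x = Some y}"
  have finP: "finite ?P"
    using fin by auto
  have "(\<Sum>x\<in>?P. w x * jump_rate R step x y)
      = (\<Sum>x\<in>?P. \<Sum>e\<in>UNIV. if step e x = Some y then R e * w x else 0)"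
    by (simp add: jump_rate_def sum_distrib_left mult.commute sum.If_cases Int_def)
  also have "\<dots> = (\<Sum>e\<in>UNIV. \<Sum>x\<in>?P. if step e x = Some y then R e * w x else 0)"
    by (rule sum.swap)
  also have "\<dots> = (\<Sum>e\<in>UNIV. R e * (\<Sum>x | step e x = Some y. w x))"
  proof (rule sum.cong[OF refl])
    fix e
    have "?P \<inter> {x. step e x = Some y} = {x. step e x = Some y}"
      by auto
    then show "(\<Sum>x\<in>?P. if step e x = Some y then R e * w x else 0)
        = R e * (\<Sum>x | step e x = Some y. w x)"
      using finP by (simp add: sum.If_cases sum_distrib_left)
  qed
  also have "\<dots> = w y * (\<Sum>e | step e y \<noteq> None. R e)"
    by (rule flow)
  finally show "((\<lambda>x. w x * jump_rate R step x y) has_sum (w y * (\<Sum>e | step e y \<noteq> None. R e))) UNIV"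
    using finP by (intro has_sum_finite_neutralI[of ?P])
      (auto simp: jump_rate_def intro!: sum.neutral)
qed

lemma steady_state_imp_invariant:
  "steady_state (jump_rate R step) s0 p \<Longrightarrow> invariant (uniformized R step) (pmf p)"
  by (rule balanced_imp_invariant) (auto simp: steady_state_def balanced_def)

lemma reachable_induct [consumes 1, case_names initial step]:
  assumes "s \<in> reachable (jump_rate R step) s0" and "P s0"
    and "\<And>e x y. P x \<Longrightarrow> step e x = Some y \<Longrightarrow> P y"
  shows "P s"
proof -
  have "(s0, s) \<in> {(x, y). 0 < jump_rate R step x y}\<^sup>*"
    using assms(1) by (simp add: reachable_def)
  then show ?thesis
  proof (induction rule: rtrancl_induct)
    case (step x y)
    then have "{e. step e x = Some y} \<noteq> {}"
      by (metis (mono_tags, lifting) case_prodD jump_rate_def less_irrefl mem_Collect_eq sum.empty)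
    with step assms(3) show ?case
      by blast
  qed (rule assms(2))
qed

text \<open>Lumping: a function of the state that commutes with the events on the support of an
  invariant distribution maps it to an invariant distribution.\<close>

lemma invariant_map_pmf:
  assumes inv: "invariant (uniformized R step) (pmf p)"
    and commute: "\<And>e x. x \<in> set_pmf p \<Longrightarrow> step' e (f x) = map_option f (step e x)"
  shows "invariant (uniformized R step') (pmf (map_pmf f p))"
proof -
  have eq: "map_pmf f (uniformized R step x) = uniformized R step' (f x)" if "x \<in> set_pmf p" for x
    using commute[OF that] unfolding uniformized_def map_pmf_comp
    by (intro map_pmf_cong) (auto split: option.splits)
  have "map_pmf f p = map_pmf f (bind_pmf p (uniformized R step))"
    using inv by (simp add: invariant_pmf_iff)
  also have "\<dots> = bind_pmf (map_pmf f p) (uniformized R step')"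
    unfolding map_bind_pmf bind_map_pmf using eq by (intro bind_pmf_cong) auto
  finally show ?thesis
    by (simp add: invariant_pmf_iff)
qed

end

text \<open>Summing the hypothesis over \<open>m < k\<close> and \<open>n \<ge> k\<close> gives
  \<open>P(Y \<ge> k) P(X < k) \<le> P(Y < k) P(X \<ge> k)\<close>; passing to complements cancels
  the product of the two tails.\<close>

lemma likelihood_ratio_imp_tail_le:
  fixes X Y :: "nat pmf"
  assumes lr: "\<And>m n. m \<le> n \<Longrightarrow> pmf Y n * pmf X m \<le> pmf Y m * pmf X n"
  shows "measure_pmf.prob Y {k..} \<le> measure_pmf.prob X {k..}"
proof -
  have tail: "measure_pmf.prob Y {k..} * pmf X m \<le> pmf Y m * measure_pmf.prob X {k..}" if "m < k" for m
  proof -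
    have "measure_pmf.prob Y {k..} * pmf X m = (\<integral>n. pmf Y n * pmf X m \<partial>count_space {k..})"
      by (simp add: integral_pmf)
    also have "\<dots> \<le> (\<integral>n. pmf Y m * pmf X n \<partial>count_space {k..})"
      using that by (intro integral_mono integrable_mult_left integrable_mult_right integrable_pmf lr) auto
    also have "\<dots> = pmf Y m * measure_pmf.prob X {k..}"
      by (simp add: integral_pmf)
    finally show ?thesis .
  qed
  have compl: "(\<Sum>m<k. pmf Z m) = 1 - measure_pmf.prob Z {k..}" for Z :: "nat pmf"
  proof -
    have "UNIV - {k..} = {..<k}"
      by auto
    then show ?thesis
      using measure_pmf.prob_compl[of "{k..}" Z] by (simp add: measure_measure_pmf_finite)
  qed
  have "measure_pmf.prob Y {k..} * (\<Sum>m<k. pmf X m) \<le> (\<Sum>m<k. pmf Y m) * measure_pmf.prob X {k..}"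
    unfolding sum_distrib_left sum_distrib_right by (intro sum_mono tail) simp
  then show ?thesis
    by (simp add: compl algebra_simps)
qed

section \<open>The two systems\<close>

lemma UNIV_ctype: "(UNIV :: ctype set) = {Type1, Type2}"
proof (rule UNIV_eq_I)
  show "x \<in> {Type1, Type2}" for x
    by (cases x) auto
qed

lemma UNIV_server: "(UNIV :: server set) = {Server1, Server2}"
proof (rule UNIV_eq_I)
  show "x \<in> {Server1, Server2}" for x
    by (cases x) auto
qed

instance ctype :: finite
  by standard (simp add: UNIV_ctype)

instance server :: finite
  by standard (simp add: UNIV_server)

lemma count_list_ctype: "count_list xs Type1 + count_list xs Type2 = length xs"
proof (induction xs)
  case (Cons x xs)
  then show ?case by (cases x) auto
qed simp

lemma find_eq_filter: "find P xs = (case filter P xs of [] \<Rightarrow> None | x # _ \<Rightarrow> Some x)"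
  by (induction xs) auto

lemma replicate_length_Type2: "Type1 \<notin> set w \<Longrightarrow> replicate (length w) Type2 = w"
  by (rule replicate_length_same) (metis ctype.exhaust)

lemma sum_event: "(\<Sum>e\<in>UNIV. f e) = f (Arrival Type1) + f (Arrival Type2) +
    (f (Completion Server1) + f (Completion Server2))"
  for f :: "event \<Rightarrow> real"
  by (simp add: UNIV_event)

lemma sum_event_filter: "(\<Sum>e | P e. f e) =
    (if P (Arrival Type1) then f (Arrival Type1) else 0) +
    (if P (Arrival Type2) then f (Arrival Type2) else 0) +
    ((if P (Completion Server1) then f (Completion Server1) else 0) +
     (if P (Completion Server2) then f (Completion Server2) else 0))"
  for f :: "event \<Rightarrow> real"
proof -
  have "(\<Sum>e | P e. f e) = (\<Sum>e\<in>UNIV. if P e then f e else 0)"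
    by (simp add: sum.If_cases)
  then show ?thesis
    by (simp only: sum_event)
qed

section \<open>Completions in the Redundancy Service chain and their predecessors\<close>

lemma find_compatible_Server1: "find (\<lambda>i. compatible i Server1) w = (if Type1 \<in> set w then Some Type1 else None)"
proof (induction w)
  case (Cons i w)
  then show ?case by (cases i) auto
qed simp

lemma find_compatible_Server2: "find (\<lambda>i. compatible i Server2) w = (if w = [] then None else Some (hd w))"
proof (cases w)
  case (Cons i w')
  then show ?thesis by (cases i) auto
qed simp

text \<open>In this form the customer removed is the one that a FCFS-ALIS server would take next
  from the same list, which is how \<open>Both w\<close> inherits the Redundancy Service
  transitions.\<close>

lemma red_step_Completion: "red_step (Completion j) w =
    map_option (\<lambda>i. remove1 i w) (find (\<lambda>i. compatible i j) w)"
  by (simp add: copy_queue_def find_eq_filter split: list.splits)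

declare red_step.simps(2) [simp del]

lemma red_step_Server1:
  "red_step (Completion Server1) [] = None"
  "red_step (Completion Server1) (Type1 # w) = Some w"
  "red_step (Completion Server1) (Type2 # w) =
    map_option ((#) Type2) (red_step (Completion Server1) w)"
  by (simp_all add: red_step_Completion find_compatible_Server1)

lemma red_step_Server2:
  "red_step (Completion Server2) [] = None"
  "red_step (Completion Server2) (i # w) = Some w"
  by (simp_all add: red_step_Completion find_compatible_Server2)

lemma red_step_Server1_eq_None: "red_step (Completion Server1) w = None \<longleftrightarrow> Type1 \<notin> set w"
proof (induction w)
  case (Cons i w)
  then show ?case by (cases i) (auto simp: red_step_Server1)
qed (simp add: red_step_Server1)

lemma red_step_Server2_eq_None: "red_step (Completion Server2) w = None \<longleftrightarrow> w = []"
  by (cases w) (simp_all add: red_step_Server2)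

lemma red_pre_Server2:
  "{x. red_step (Completion Server2) x = Some w} = {Type1 # w, Type2 # w}"
proof (rule set_eqI)
  fix x
  show "x \<in> {x. red_step (Completion Server2) x = Some w} \<longleftrightarrow> x \<in> {Type1 # w, Type2 # w}"
  proof (cases x)
    case (Cons i x')
    then show ?thesis
      by (cases i) (auto simp: red_step_Server2)
  qed (simp add: red_step_Server2)
qed

definition red_pre :: "ctype list \<Rightarrow> ctype list set" where
  "red_pre w = {x. red_step (Completion Server1) x = Some w}"

text \<open>Server 1 removes the first type 1 customer, so a predecessor has a \<open>Type1\<close>
  inserted in the leading run of type 2 customers, ends included; the recursion follows that
  run.\<close>

lemma red_pre_simps:
  "red_pre [] = {[Type1]}"
  "red_pre (Type1 # w) = {Type1 # Type1 # w}"
  "red_pre (Type2 # w) = insert (Type1 # Type2 # w) ((#) Type2 ` red_pre w)"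
proof -
  have *: "x \<in> red_pre w \<longleftrightarrow> x = Type1 # w \<or> (\<exists>x' w'. x = Type2 # x' \<and> w = Type2 # w' \<and> x' \<in> red_pre w')"
    for x w
  proof (cases x)
    case Nil
    then show ?thesis by (simp add: red_pre_def red_step_Server1)
  next
    case (Cons i x')
    then show ?thesis
      by (cases i) (auto simp: red_pre_def red_step_Server1)
  qed
  show "red_pre [] = {[Type1]}"
    by (rule set_eqI, subst *) auto
  show "red_pre (Type1 # w) = {Type1 # Type1 # w}"
    by (rule set_eqI, subst *) auto
  show "red_pre (Type2 # w) = insert (Type1 # Type2 # w) ((#) Type2 ` red_pre w)"
    by (rule set_eqI, subst *) auto
qed

lemma finite_red_pre: "finite (red_pre w)"
proof (induction w)
  case (Cons i w)
  then show ?case by (cases i) (auto simp: red_pre_simps)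
qed (simp add: red_pre_simps)

lemma snoc_pre: "{x. x @ [i] = w} = (if w \<noteq> [] \<and> last w = i then {butlast w} else {})"
  by (auto simp: snoc_eq_iff_butlast)

lemma finite_red_step_pre: "finite {x. red_step e x = Some w}"
proof (cases e)
  case (Arrival i)
  then show ?thesis by (simp add: snoc_pre)
next
  case (Completion j)
  then show ?thesis
    using finite_red_pre[of w] by (cases j) (simp_all add: red_pre_Server2 red_pre_def)
qed

section \<open>The lumped FCFS-ALIS chain\<close>

text \<open>\<open>Idle12\<close> and \<open>Idle21\<close> list the idle servers, the longest idle one first. In \<open>Only1\<close> server 1
  alone is busy, and nobody waits. In \<open>Only2 k\<close> server 2 alone is busy, and the \<open>k\<close> waiting customers
  must be of type 2. In \<open>Both w\<close> both servers are busy, and \<open>w\<close> lists the waiting customers.\<close>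

datatype lumped = Idle12 | Idle21 | Only1 | Only2 nat | Both "ctype list"

text \<open>The types in service can be forgotten because service rates depend on the server only. A
  completion in \<open>Both w\<close> starts the customer that Redundancy Service would remove from
  \<open>w\<close>; if there is none, the server idles.\<close>

fun lumped_step :: "event \<Rightarrow> lumped \<Rightarrow> lumped option" where
  "lumped_step (Arrival i) Idle12 = Some (if i = Type1 then Only1 else Only2 0)"
| "lumped_step (Arrival i) Idle21 = Some (Only2 0)"
| "lumped_step (Arrival i) Only1 = Some (Both [])"
| "lumped_step (Arrival i) (Only2 k) =
    Some (if i = Type1 then Both (replicate k Type2) else Only2 (Suc k))"
| "lumped_step (Arrival i) (Both w) = Some (Both (w @ [i]))"
| "lumped_step (Completion j) Idle12 = None"
| "lumped_step (Completion j) Idle21 = None"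
| "lumped_step (Completion j) Only1 = (if j = Server1 then Some Idle21 else None)"
| "lumped_step (Completion j) (Only2 k) =
    (if j = Server1 then None else Some (case k of 0 \<Rightarrow> Idle12 | Suc k \<Rightarrow> Only2 k))"
| "lumped_step (Completion j) (Both w) =
    Some (case red_step (Completion j) w of
      None \<Rightarrow> if j = Server1 then Only2 (length w) else Only1
    | Some w' \<Rightarrow> Both w')"

fun lumped_number :: "lumped \<Rightarrow> nat" where
  "lumped_number Idle12 = 0"
| "lumped_number Idle21 = 0"
| "lumped_number Only1 = 1"
| "lumped_number (Only2 k) = k + 1"
| "lumped_number (Both w) = length w + 2"

text \<open>On valid states the last branch is \<open>[Server2, Server1]\<close>.\<close>

definition lump :: "fcfs_state \<Rightarrow> lumped" where
  "lump s =
    (if idle s = [] then Both (waiting s)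
     else if idle s = [Server1] then Only2 (length (waiting s))
     else if idle s = [Server2] then Only1
     else if idle s = [Server1, Server2] then Idle12
     else Idle21)"

text \<open>Work conservation, which holds in all reachable states and makes \<open>lump\<close>
  commute with the events.\<close>

definition fcfs_valid :: "fcfs_state \<Rightarrow> bool" where
  "fcfs_valid s \<longleftrightarrow>
    idle s \<in> {[], [Server1], [Server2], [Server1, Server2], [Server2, Server1]} \<and>
    (\<forall>j. serving s j = None \<longleftrightarrow> j \<in> set (idle s)) \<and>
    (Server2 \<in> set (idle s) \<longrightarrow> waiting s = []) \<and>
    (Server1 \<in> set (idle s) \<longrightarrow> Type1 \<notin> set (waiting s))"

lemma event_exhaust:
  obtains "e = Arrival Type1" | "e = Arrival Type2"
    | "e = Completion Server1" | "e = Completion Server2"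
proof (cases e)
  case (Arrival i)
  then show thesis using that by (cases i) auto
next
  case (Completion j)
  then show thesis using that by (cases j) auto
qed

lemma fcfs_valid_cases:
  assumes "fcfs_valid s"
  obtains "idle s = []" | "idle s = [Server1]" "Type1 \<notin> set (waiting s)"
    | "idle s = [Server2]" "waiting s = []"
    | "idle s = [Server1, Server2]" "waiting s = []" | "idle s = [Server2, Server1]" "waiting s = []"
  using assms by (auto simp: fcfs_valid_def)

lemma all_server: "(\<forall>j. P j) \<longleftrightarrow> P Server1 \<and> P Server2"
  by (metis server.exhaust)

lemma fcfs_valid_serving:
  assumes "fcfs_valid s"
  shows "serving s Server1 = None \<longleftrightarrow> Server1 \<in> set (idle s)"
    and "serving s Server2 = None \<longleftrightarrow> Server2 \<in> set (idle s)"
  using assms by (simp_all add: fcfs_valid_def)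

lemma fcfs_valid_step:
  assumes valid: "fcfs_valid s" and step: "fcfs_step e s = Some s'"
  shows "fcfs_valid s'"
  using valid
  by (cases s rule: fcfs_valid_cases) (use fcfs_valid_serving[OF valid] step in \<open>cases e rule: event_exhaust;
    simp add: fcfs_valid_def all_server find_compatible_Server1 find_compatible_Server2 split: if_splits;
    (auto dest: notin_set_remove1)?\<close>)+

text \<open>The commutation that lumping requires. Wherever \<open>lump\<close> drops the waiting
  list, validity restores it: it is empty if server 2 is idle, and consists of type 2 customers if
  only server 1 is.\<close>

lemma lumped_step_lump:
  assumes valid: "fcfs_valid s"
  shows "lumped_step e (lump s) = map_option lump (fcfs_step e s)"
  using valid
  by (cases s rule: fcfs_valid_cases) (use fcfs_valid_serving[OF valid] in \<open>cases e rule: event_exhaust;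
    simp add: lump_def find_compatible_Server1 find_compatible_Server2 red_step_Completion
        replicate_length_Type2 length_remove1 split: nat.splits\<close>)+

text \<open>Every server that is not idle holds exactly one customer, so the customers in service
  number the busy servers.\<close>

lemma lumped_number_lump:
  assumes "fcfs_valid s"
  shows "fcfs_number Type1 s + fcfs_number Type2 s = lumped_number (lump s)"
proof -
  have *: "(x = Some Type1 \<or> x = Some Type2) \<longleftrightarrow> x \<noteq> None" for x
    by (cases x; cases "the x") auto
  have "card {j. serving s j = Some Type1} + card {j. serving s j = Some Type2}
      = card ({j. serving s j = Some Type1} \<union> {j. serving s j = Some Type2})"
    by (rule card_Un_disjoint[symmetric]) auto
  also have "{j. serving s j = Some Type1} \<union> {j. serving s j = Some Type2} = {j. serving s j \<noteq> None}"
    unfolding Un_def mem_Collect_eq * by simp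
  also have "\<dots> = UNIV - set (idle s)"
    using assms by (simp add: fcfs_valid_def set_eq_iff)
  finally have "fcfs_number Type1 s + fcfs_number Type2 s
      = length (waiting s) + card (UNIV - set (idle s))"
    using count_list_ctype[of "waiting s"] by (simp add: fcfs_number_def)
  also have "\<dots> = lumped_number (lump s)"
    using assms by (cases s rule: fcfs_valid_cases) (simp_all add: lump_def UNIV_server)
  finally show ?thesis .
qed

section \<open>Predecessors in the lumped chain\<close>

lemma replicate_Type2_eq_iff: "replicate k Type2 = w \<longleftrightarrow> Type1 \<notin> set w \<and> k = length w"
  by (auto simp: replicate_length_Type2)

lemma lumped_step_Both_Completion:
  "lumped_step (Completion Server1) (Both w) = Some z \<longleftrightarrow>
    (Type1 \<notin> set w \<and> z = Only2 (length w)) \<or>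
    (\<exists>w'. z = Both w' \<and> red_step (Completion Server1) w = Some w')"
  "lumped_step (Completion Server2) (Both w) = Some z \<longleftrightarrow>
    (w = [] \<and> z = Only1) \<or> (\<exists>w'. z = Both w' \<and> red_step (Completion Server2) w = Some w')"
  by (cases "red_step (Completion Server1) w"; force simp: red_step_Server1_eq_None[symmetric])
    (cases "red_step (Completion Server2) w"; force simp: red_step_Server2_eq_None[symmetric])

lemma lumped_pre_Idle12:
  "{x. lumped_step e x = Some Idle12} = (if e = Completion Server2 then {Only2 0} else {})"
proof (rule set_eqI)
  fix x
  show "x \<in> {x. lumped_step e x = Some Idle12} \<longleftrightarrow>
      x \<in> (if e = Completion Server2 then {Only2 0} else {})"
    by (cases e rule: event_exhaust; cases x)
      (simp_all add: lumped_step_Both_Completion del: lumped_step.simps(10) split: nat.splits)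
qed

lemma lumped_pre_Idle21:
  "{x. lumped_step e x = Some Idle21} = (if e = Completion Server1 then {Only1} else {})"
proof (rule set_eqI)
  fix x
  show "x \<in> {x. lumped_step e x = Some Idle21} \<longleftrightarrow>
      x \<in> (if e = Completion Server1 then {Only1} else {})"
    by (cases e rule: event_exhaust; cases x)
      (simp_all add: lumped_step_Both_Completion del: lumped_step.simps(10) split: nat.splits)
qed

lemma lumped_pre_Only1:
  "{x. lumped_step e x = Some Only1} =
    (if e = Arrival Type1 then {Idle12} else if e = Completion Server2 then {Both []} else {})"
proof (rule set_eqI)
  fix x
  show "x \<in> {x. lumped_step e x = Some Only1} \<longleftrightarrow>
      x \<in> (if e = Arrival Type1 then {Idle12} else if e = Completion Server2 then {Both []} else {})"
    by (cases e rule: event_exhaust; cases x)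
      (simp_all add: lumped_step_Both_Completion del: lumped_step.simps(10) split: nat.splits)
qed

lemma lumped_pre_Only2:
  "{x. lumped_step (Arrival Type1) x = Some (Only2 k)} = (if k = 0 then {Idle21} else {})"
  "{x. lumped_step (Arrival Type2) x = Some (Only2 k)} =
    (if k = 0 then {Idle12, Idle21} else {Only2 (k - 1)})"
  "{x. lumped_step (Completion Server1) x = Some (Only2 k)} = {Both (replicate k Type2)}"
  "{x. lumped_step (Completion Server2) x = Some (Only2 k)} = {Only2 (Suc k)}"
proof -
  have "lumped_step (Arrival Type1) x = Some (Only2 k) \<longleftrightarrow> k = 0 \<and> x = Idle21" for x
    by (cases x) auto
  then show "{x. lumped_step (Arrival Type1) x = Some (Only2 k)} = (if k = 0 then {Idle21} else {})"
    by auto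
  have "lumped_step (Arrival Type2) x = Some (Only2 k) \<longleftrightarrow>
      k = 0 \<and> (x = Idle12 \<or> x = Idle21) \<or> k \<noteq> 0 \<and> x = Only2 (k - 1)" for x
    by (cases x) auto
  then show "{x. lumped_step (Arrival Type2) x = Some (Only2 k)} =
      (if k = 0 then {Idle12, Idle21} else {Only2 (k - 1)})"
    by auto
  have "lumped_step (Completion Server1) x = Some (Only2 k) \<longleftrightarrow> x = Both (replicate k Type2)" for x
    by (cases x) (auto simp: lumped_step_Both_Completion replicate_length_Type2 simp del: lumped_step.simps(10))
  then show "{x. lumped_step (Completion Server1) x = Some (Only2 k)} = {Both (replicate k Type2)}"
    by auto
  have "lumped_step (Completion Server2) x = Some (Only2 k) \<longleftrightarrow> x = Only2 (Suc k)" for x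
    by (cases x) (auto simp: lumped_step_Both_Completion simp del: lumped_step.simps(10) split: nat.splits)
  then show "{x. lumped_step (Completion Server2) x = Some (Only2 k)} = {Only2 (Suc k)}"
    by auto
qed

lemma lumped_pre_Both:
  "{x. lumped_step (Arrival Type1) x = Some (Both w)} = Both ` {x. x @ [Type1] = w} \<union>
    ((if w = [] then {Only1} else {}) \<union> (if Type1 \<in> set w then {} else {Only2 (length w)}))"
  "{x. lumped_step (Arrival Type2) x = Some (Both w)} = Both ` {x. x @ [Type2] = w} \<union>
    (if w = [] then {Only1} else {})"
  "{x. lumped_step (Completion j) x = Some (Both w)} = Both ` {x. red_step (Completion j) x = Some w}"
proof -
  have "lumped_step (Arrival Type1) x = Some (Both w) \<longleftrightarrow> (\<exists>v. x = Both v \<and> v @ [Type1] = w) \<or>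
      w = [] \<and> x = Only1 \<or> Type1 \<notin> set w \<and> x = Only2 (length w)" for x
    by (cases x) (auto simp: replicate_Type2_eq_iff)
  then show "{x. lumped_step (Arrival Type1) x = Some (Both w)} = Both ` {x. x @ [Type1] = w} \<union>
      ((if w = [] then {Only1} else {}) \<union> (if Type1 \<in> set w then {} else {Only2 (length w)}))"
    by auto
  have "lumped_step (Arrival Type2) x = Some (Both w) \<longleftrightarrow> (\<exists>v. x = Both v \<and> v @ [Type2] = w) \<or>
      w = [] \<and> x = Only1" for x
    by (cases x) auto
  then show "{x. lumped_step (Arrival Type2) x = Some (Both w)} = Both ` {x. x @ [Type2] = w} \<union>
      (if w = [] then {Only1} else {})"
    by auto
  have "lumped_step (Completion j) x = Some (Both w) \<longleftrightarrow>
      (\<exists>v. x = Both v \<and> red_step (Completion j) v = Some w)" for x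
    by (cases j; cases x)
      (auto simp: lumped_step_Both_Completion simp del: lumped_step.simps(10) split: nat.splits)
  then show "{x. lumped_step (Completion j) x = Some (Both w)} = Both ` {x. red_step (Completion j) x = Some w}"
    by auto
qed

lemma finite_lumped_step_pre: "finite {x. lumped_step e x = Some y}"
proof (cases y)
  case (Only2 k)
  then show ?thesis
    by (cases e rule: event_exhaust) (simp_all only: lumped_pre_Only2, simp_all)
next
  case (Both w)
  then show ?thesis
    using finite_red_step_pre[of _ w]
    by (cases e rule: event_exhaust) (simp_all only: lumped_pre_Both, simp_all add: snoc_pre)
qed (simp_all add: lumped_pre_Idle12 lumped_pre_Idle21 lumped_pre_Only1)

section \<open>Stationary weights\<close>

locale n_system =
  fixes lam :: "ctype \<Rightarrow> real" and mu :: "server \<Rightarrow> real"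
  assumes lam_pos: "0 < lam i" and mu_pos: "0 < mu j"
begin

text \<open>The product form: the factor of the \<open>k\<close>-th customer is its arrival rate divided by the total
  service rate of the first \<open>k\<close> customers, which is \<open>\<mu>\<^sub>2\<close> as long as all of them are of type 2.\<close>

fun red_weight :: "ctype list \<Rightarrow> real" where
  "red_weight [] = 1"
| "red_weight (Type1 # w) =
    lam Type1 / (mu Server1 + mu Server2) * (\<Prod>i\<leftarrow>w. lam i / (mu Server1 + mu Server2))"
| "red_weight (Type2 # w) = lam Type2 / mu Server2 * red_weight w"

text \<open>Found by cutting the flow at \<open>Both w\<close>: the Redundancy Service balance at \<open>w\<close> lacks the
  completions from \<open>Both w\<close> at a server to which no waiting customer is compatible, and these must be
  matched by the arrivals from \<open>Only2\<close> and \<open>Only1\<close>.\<close>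

fun lumped_weight :: "lumped \<Rightarrow> real" where
  "lumped_weight Idle12 = mu Server1 * mu Server2 / ((lam Type1 + lam Type2) * lam Type1)"
| "lumped_weight Idle21 = mu Server1 * mu Server2 / (lam Type1 + lam Type2)\<^sup>2"
| "lumped_weight Only1 = mu Server2 / (lam Type1 + lam Type2)"
| "lumped_weight (Only2 k) = mu Server1 / lam Type1 * (lam Type2 / mu Server2) ^ k"
| "lumped_weight (Both w) = red_weight w"

lemma pos [simp]: "0 < lam Type1" "0 < lam Type2" "0 < mu Server1" "0 < mu Server2"
    "0 < lam Type1 + lam Type2" "0 < mu Server1 + mu Server2"
  using lam_pos mu_pos by (simp_all add: add_pos_pos)

lemma nonzero [simp]: "lam Type1 \<noteq> 0" "lam Type2 \<noteq> 0" "mu Server1 \<noteq> 0" "mu Server2 \<noteq> 0"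
    "lam Type1 + lam Type2 \<noteq> 0" "mu Server1 + mu Server2 \<noteq> 0"
  using pos by (simp_all only: less_imp_neq[symmetric] not_False_eq_True)

lemma red_weight_pos: "0 < red_weight w"
proof (induction w rule: red_weight.induct)
  case (2 w)
  have "0 < (\<Prod>i\<leftarrow>w. lam i / (mu Server1 + mu Server2))"
    by (induction w) (simp_all add: lam_pos)
  then show ?case by simp
qed simp_all

lemma lumped_weight_pos: "0 < lumped_weight x"
  by (cases x) (simp_all add: red_weight_pos)

lemma red_weight_replicate: "red_weight (replicate k Type2) = (lam Type2 / mu Server2) ^ k"
  by (induction k) simp_all

section \<open>Partial balance of the product-form weights\<close>

definition service_rate :: "ctype list \<Rightarrow> real" where
  "service_rate w = (if Type1 \<in> set w then mu Server1 else 0) + (if w = [] then 0 else mu Server2)"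

text \<open>Reads the product form from its end, where the denominator of the last factor is the
  service rate of the whole list.\<close>

lemma red_weight_snoc: "red_weight (w @ [i]) * service_rate (w @ [i]) = lam i * red_weight w"
proof (induction w rule: red_weight.induct)
  case 1
  show ?case by (cases i) (simp_all add: service_rate_def)
next
  case (2 w)
  show ?case by (simp add: service_rate_def)
next
  case (3 w)
  have "service_rate ((Type2 # w) @ [i]) = service_rate (w @ [i])"
    by (simp add: service_rate_def)
  with 3 show ?case by (simp add: mult.assoc)
qed

text \<open>The only predecessor through an arrival drops the last customer, so
  \<open>red_weight_snoc\<close> matches arrivals into \<open>w\<close> with completions out of
  it.\<close>

lemma arrival_flow:
  "(\<Sum>i\<in>UNIV. lam i * (\<Sum>x | x @ [i] = w. red_weight x)) = service_rate w * red_weight w"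
proof (cases w rule: rev_cases)
  case Nil
  then show ?thesis by (simp add: service_rate_def)
next
  case (snoc v j)
  then show ?thesis
    using red_weight_snoc[of v j]
    by (cases j) (simp_all add: UNIV_ctype snoc_pre mult.commute)
qed

text \<open>Departures of type 1 customers into \<open>w\<close> match type 1 arrivals out of it.
  Server 1 leads there from \<open>red_pre w\<close>, server 2 from \<open>Type1 # w\<close>; the
  induction follows the leading type 2 customers.\<close>

lemma completion_flow_Type1:
  "mu Server1 * (\<Sum>x\<in>red_pre w. red_weight x) + mu Server2 * red_weight (Type1 # w)
    = lam Type1 * red_weight w"
proof (induction w rule: red_weight.induct)
  case 1
  show ?case by (simp add: red_pre_simps flip: distrib_right add_divide_distrib)
next
  case (2 w)
  show ?case by (simp add: red_pre_simps flip: distrib_right add_divide_distrib)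
next
  case (3 w)
  have "(\<Sum>x\<in>red_pre (Type2 # w). red_weight x)
      = red_weight (Type1 # Type2 # w) + lam Type2 / mu Server2 * (\<Sum>x\<in>red_pre w. red_weight x)"
    using finite_red_pre[of w]
    by (simp add: red_pre_simps sum.insert image_iff sum.reindex sum_distrib_left)
  then have "mu Server1 * (\<Sum>x\<in>red_pre (Type2 # w). red_weight x) + mu Server2 * red_weight (Type1 # Type2 # w)
      = (mu Server1 + mu Server2) * red_weight (Type1 # Type2 # w)
        + lam Type2 / mu Server2 * (mu Server1 * (\<Sum>x\<in>red_pre w. red_weight x))"
    by (simp only: algebra_simps)
  \<comment> \<open>Provides the server 2 term of the induction hypothesis, scaled by
    \<open>lam Type2 / mu Server2\<close>.\<close>
  also have "(mu Server1 + mu Server2) * red_weight (Type1 # Type2 # w)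
      = lam Type2 * red_weight (Type1 # w)"
    by simp
  also have "lam Type2 * red_weight (Type1 # w)
        + lam Type2 / mu Server2 * (mu Server1 * (\<Sum>x\<in>red_pre w. red_weight x))
      = lam Type2 / mu Server2 * (mu Server1 * (\<Sum>x\<in>red_pre w. red_weight x) + mu Server2 * red_weight (Type1 # w))"
    by (simp add: distrib_left del: red_weight.simps)
  also have "\<dots> = lam Type1 * red_weight (Type2 # w)"
    unfolding 3 by simp
  finally show ?case .
qed

text \<open>Type 2 departures balance type 2 arrivals on their own: they come only from
  \<open>Type2 # w\<close>, whose weight has the extra factor
  \<open>lam Type2 / mu Server2\<close>.\<close>

lemma completion_flow:
  "mu Server1 * (\<Sum>x\<in>red_pre w. red_weight x)
    + mu Server2 * (red_weight (Type1 # w) + red_weight (Type2 # w))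
    = (lam Type1 + lam Type2) * red_weight w"
  using completion_flow_Type1[of w] by (simp add: algebra_simps)

sublocale red: jump_chain "event_rate lam mu" red_step
  by standard (metis event.exhaust event_rate.simps lam_pos mu_pos)

sublocale lumped: jump_chain "event_rate lam mu" lumped_step
  by standard (rule red.rate_pos)

sublocale fcfs: jump_chain "event_rate lam mu" fcfs_step
  by standard (rule red.rate_pos)

text \<open>The sum of two partial balances: arrivals in against completions out, and completions in
  against arrivals out.\<close>

lemma red_balanced: "balanced (jump_rate (event_rate lam mu) red_step) red_weight"
proof (rule red.balancedI[OF finite_red_step_pre])
  fix w
  have out: "(\<Sum>e | red_step e w \<noteq> None. event_rate lam mu e) = lam Type1 + lam Type2 + service_rate w"
    unfolding sum_event_filter
    by (simp add: red_step_Server1_eq_None red_step_Server2_eq_None service_rate_def)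
  show "(\<Sum>e\<in>UNIV. event_rate lam mu e * (\<Sum>x | red_step e x = Some w. red_weight x))
      = red_weight w * (\<Sum>e | red_step e w \<noteq> None. event_rate lam mu e)"
    unfolding sum_event out red_pre_def[symmetric] red_pre_Server2
    using arrival_flow[of w] completion_flow[of w]
    by (simp add: UNIV_ctype algebra_simps del: red_weight.simps)
qed

lemma sum_Both_Un:
  assumes "finite A" "finite B" "Both ` A \<inter> B = {}"
  shows "(\<Sum>x\<in>Both ` A \<union> B. lumped_weight x) = (\<Sum>x\<in>A. red_weight x) + (\<Sum>x\<in>B. lumped_weight x)"
  using assms by (simp add: sum.union_disjoint sum.reindex inj_on_def)

lemma lumped_balanced: "balanced (jump_rate (event_rate lam mu) lumped_step) lumped_weight"
proof (rule lumped.balancedI[OF finite_lumped_step_pre])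
  fix y
  show "(\<Sum>e\<in>UNIV. event_rate lam mu e * (\<Sum>x | lumped_step e x = Some y. lumped_weight x))
      = lumped_weight y * (\<Sum>e | lumped_step e y \<noteq> None. event_rate lam mu e)"
    (is "?inflow = _")
  proof (cases y)
    case Idle12
    then show ?thesis
      by (simp add: sum_event sum_event_filter lumped_pre_Idle12 mult.commute)
  next
    case Idle21
    then show ?thesis
      by (simp add: sum_event sum_event_filter lumped_pre_Idle21 power2_eq_square mult.commute)
  next
    case Only1
    define l where "l = lam Type1 + lam Type2"
    have "l \<noteq> 0"
      unfolding l_def by simp
    then have "lam Type1 * (mu Server1 * mu Server2 / (l * lam Type1)) + mu Server2
        = mu Server2 / l * (l + mu Server1)"
      by (simp add: field_simps)
    then show ?thesis
      by (simp add: Only1 sum_event sum_event_filter lumped_pre_Only1 l_def)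
  next
    case (Only2 k)
    show ?thesis
    proof (cases k)
      case 0
      define l where "l = lam Type1 + lam Type2"
      have "l \<noteq> 0"
        unfolding l_def by simp
      \<comment> \<open>Inflow from the two idle states matches the outflow of
        \<open>Only2 0\<close> by completions; the remaining inflow matches its arrivals.
        \<open>lam Type2\<close> is written as \<open>l - lam Type1\<close>.\<close>
      then have "lam Type1 * (mu Server1 * mu Server2 / l\<^sup>2) +
          (l - lam Type1) * (mu Server1 * mu Server2 / (l * lam Type1) + mu Server1 * mu Server2 / l\<^sup>2)
          = mu Server1 * mu Server2 / lam Type1"
        by (simp add: field_simps power2_eq_square)
      moreover have "l - lam Type1 = lam Type2"
        by (simp add: l_def)
      ultimately show ?thesis
        unfolding Only2 0 sum_event sum_event_filter lumped_pre_Only2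
        by (simp add: red_weight_replicate distrib_left l_def)
    next
      case (Suc k')
      then show ?thesis
        by (simp add: Only2 sum_event sum_event_filter lumped_pre_Only2 red_weight_replicate field_simps)
    qed
  next
    case (Both w)
    have repl: "red_weight w = (lam Type2 / mu Server2) ^ length w" if "Type1 \<notin> set w"
      using that red_weight_replicate[of "length w"] by (simp add: replicate_length_Type2)
    have arrival1: "(\<Sum>x | lumped_step (Arrival Type1) x = Some (Both w). lumped_weight x) =
        (\<Sum>x | x @ [Type1] = w. red_weight x) +
        ((if w = [] then mu Server2 / (lam Type1 + lam Type2) else 0) +
         (if Type1 \<in> set w then 0 else mu Server1 / lam Type1 * red_weight w))"
      unfolding lumped_pre_Both
      by (subst sum_Both_Un) (auto simp: snoc_pre repl sum.union_disjoint)
    have arrival2: "(\<Sum>x | lumped_step (Arrival Type2) x = Some (Both w). lumped_weight x) =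
        (\<Sum>x | x @ [Type2] = w. red_weight x) +
        (if w = [] then mu Server2 / (lam Type1 + lam Type2) else 0)"
      unfolding lumped_pre_Both by (subst sum_Both_Un) (auto simp: snoc_pre)
    have completion: "(\<Sum>x | lumped_step (Completion j) x = Some (Both w). lumped_weight x) =
        (\<Sum>x | red_step (Completion j) x = Some w. red_weight x)" for j
      unfolding lumped_pre_Both by (simp add: sum.reindex inj_on_def)
    \<comment> \<open>The Redundancy Service inflow plus the terms from \<open>Only1\<close> and
      \<open>Only2\<close>. These raise \<open>service_rate w\<close> to
      \<open>mu Server1 + mu Server2\<close>, since they supply the rates of the servers for which
      nobody in \<open>w\<close> is compatible.\<close>
    have "?inflow = (\<Sum>i\<in>UNIV. lam i * (\<Sum>x | x @ [i] = w. red_weight x)) +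
        (mu Server1 * (\<Sum>x\<in>red_pre w. red_weight x)
          + mu Server2 * (red_weight (Type1 # w) + red_weight (Type2 # w))) +
        ((lam Type1 + lam Type2) * (if w = [] then mu Server2 / (lam Type1 + lam Type2) else 0) +
          lam Type1 * (if Type1 \<in> set w then 0 else mu Server1 / lam Type1 * red_weight w))"
      unfolding sum_event Both arrival1 arrival2 completion red_pre_def[symmetric] red_pre_Server2
      by (simp add: UNIV_ctype algebra_simps del: red_weight.simps)
    also have "(lam Type1 + lam Type2) * (if w = [] then mu Server2 / (lam Type1 + lam Type2) else 0)
        = (if w = [] then mu Server2 else 0)"
      by simp
    also have "(\<Sum>i\<in>UNIV. lam i * (\<Sum>x | x @ [i] = w. red_weight x)) +
        (mu Server1 * (\<Sum>x\<in>red_pre w. red_weight x)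
          + mu Server2 * (red_weight (Type1 # w) + red_weight (Type2 # w))) +
        ((if w = [] then mu Server2 else 0) +
          lam Type1 * (if Type1 \<in> set w then 0 else mu Server1 / lam Type1 * red_weight w))
      = red_weight w * (lam Type1 + lam Type2 + (mu Server1 + mu Server2))"
      unfolding arrival_flow completion_flow by (simp add: service_rate_def algebra_simps)
    also have "\<dots> = lumped_weight y * (\<Sum>e | lumped_step e y \<noteq> None. event_rate lam mu e)"
      unfolding sum_event_filter by (simp add: Both)
    finally show ?thesis .
  qed
qed

section \<open>Irreducibility and identification of the steady states\<close>

abbreviation "red_kernel \<equiv> uniformized (event_rate lam mu) red_step"
abbreviation "lumped_kernel \<equiv> uniformized (event_rate lam mu) lumped_step"

lemma red_reaches_empty: "(w, []) \<in> {(x, y). 0 < pmf (red_kernel x) y}\<^sup>*"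
proof (induction w)
  case (Cons i w)
  have "(i # w, w) \<in> {(x, y). 0 < pmf (red_kernel x) y}"
    using red.uniformized_pos[OF red_step_Server2(2)] by simp
  with Cons show ?case
    by (rule converse_rtrancl_into_rtrancl[rotated])
qed simp

lemma lumped_reaches: "(x, Only2 0) \<in> {(x, y). 0 < pmf (lumped_kernel x) y}\<^sup>*" (is "_ \<in> ?r\<^sup>*")
proof -
  have via: "(x, Only2 0) \<in> ?r\<^sup>*" if "lumped_step e x = Some y" "(y, Only2 0) \<in> ?r\<^sup>*" for e x y
    using that lumped.uniformized_pos[OF that(1)] by (intro converse_rtrancl_into_rtrancl[of x y]) auto
  have only2: "(Only2 k, Only2 0) \<in> ?r\<^sup>*" for k
  proof (induction k)
    case (Suc k)
    show ?case
      by (rule via[OF _ Suc, where e = "Completion Server2"]) simp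
  qed simp
  have idle21: "(Idle21, Only2 0) \<in> ?r\<^sup>*"
    by (rule via[OF _ only2[of 0], where e = "Arrival Type1"]) simp
  have only1: "(Only1, Only2 0) \<in> ?r\<^sup>*"
    by (rule via[OF _ idle21, where e = "Completion Server1"]) simp
  have both: "(Both w, Only2 0) \<in> ?r\<^sup>*" for w
  proof (induction w)
    case Nil
    show ?case
      by (rule via[OF _ only1, where e = "Completion Server2"]) (simp add: red_step_Server2)
  next
    case (Cons i w)
    show ?case
      by (rule via[OF _ Cons, where e = "Completion Server2"]) (simp add: red_step_Server2)
  qed
  have idle12: "(Idle12, Only2 0) \<in> ?r\<^sup>*"
    by (rule via[OF _ only2[of 0], where e = "Arrival Type2"]) simp
  show ?thesis
    using only2 idle21 only1 both idle12 by (cases x) auto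
qed

lemma red_steady_state_weight:
  assumes "red_steady_state lam mu pr"
  obtains c where "0 \<le> c" "\<And>w. pmf pr w = c * red_weight w"
proof (rule invariant_unique_up_to_scaling[of red_kernel pr red_weight "[]"])
  show "invariant red_kernel (pmf pr)"
    using assms by (intro red.steady_state_imp_invariant) (simp add: red_steady_state_def)
  show "invariant red_kernel red_weight"
    by (intro red.balanced_imp_invariant red_balanced less_imp_le red_weight_pos)
qed (auto simp: red_weight_pos less_imp_le red_reaches_empty that)

lemma fcfs_steady_state_valid:
  assumes "fcfs_steady_state lam mu pq" "s \<in> set_pmf pq"
  shows "fcfs_valid s"
proof -
  have "s \<in> reachable (jump_rate (event_rate lam mu) fcfs_step) fcfs_empty"
    using assms by (auto simp: fcfs_steady_state_def steady_state_def)
  then show ?thesis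
  proof (induction rule: fcfs.reachable_induct)
    case initial
    show ?case by (simp add: fcfs_valid_def fcfs_empty_def all_server)
  qed (rule fcfs_valid_step)
qed

text \<open>Identifying the law of the lumped state suffices, as the number in system depends on the
  state only through \<open>lump\<close>.\<close>

lemma fcfs_steady_state_weight:
  assumes "fcfs_steady_state lam mu pq"
  obtains c where "0 \<le> c" "\<And>x. pmf (map_pmf lump pq) x = c * lumped_weight x"
proof (rule invariant_unique_up_to_scaling[of lumped_kernel "map_pmf lump pq" lumped_weight "Only2 0"])
  show "invariant lumped_kernel (pmf (map_pmf lump pq))"
  proof (rule fcfs.invariant_map_pmf)
    show "invariant (uniformized (event_rate lam mu) fcfs_step) (pmf pq)"
      using assms by (intro fcfs.steady_state_imp_invariant) (simp add: fcfs_steady_state_def)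
  qed (rule lumped_step_lump[OF fcfs_steady_state_valid[OF assms]])
  show "invariant lumped_kernel lumped_weight"
    by (intro lumped.balanced_imp_invariant lumped_balanced less_imp_le lumped_weight_pos)
qed (auto simp: lumped_weight_pos less_imp_le lumped_reaches that)

section \<open>Comparison of the numbers in system\<close>

text \<open>This is \<open>h\<close>, split by the first customer. After a leading
  \<open>Type1\<close> every factor has denominator \<mu>, so the weights of the other
  \<open>n\<close> customers sum to an \<open>n\<close>-th power.\<close>

fun length_weight :: "nat \<Rightarrow> real" where
  "length_weight 0 = 1"
| "length_weight (Suc n) = lam Type2 / mu Server2 * length_weight n
    + lam Type1 / (mu Server1 + mu Server2) * ((lam Type1 + lam Type2) / (mu Server1 + mu Server2)) ^ n"

lemma sum_red_weight: "(\<Sum>w | length w = n. red_weight w) = length_weight n"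
proof (induction n)
  case (Suc n)
  have fin: "finite {w :: ctype list. length w = n}" for n
    using finite_lists_length_eq[of "UNIV :: ctype set" n] by simp
  have split: "(\<Sum>w | length w = Suc n. f w) =
      (\<Sum>w | length w = n. f (Type1 # w)) + (\<Sum>w | length w = n. f (Type2 # w))" for f :: "_ \<Rightarrow> real" and n
  proof -
    have "{w. length w = Suc n} = (#) Type1 ` {w. length w = n} \<union> (#) Type2 ` {w. length w = n}"
    proof (rule set_eqI)
      fix w :: "ctype list"
      show "w \<in> {w. length w = Suc n} \<longleftrightarrow> w \<in> (#) Type1 ` {w. length w = n} \<union> (#) Type2 ` {w. length w = n}"
        by (cases w; cases "hd w") auto
    qed
    then show ?thesis
      unfolding \<open>{w. length w = Suc n} = _\<close>
      by (subst sum.union_disjoint) (use fin in \<open>auto simp: sum.reindex\<close>)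
  qed
  have "(\<Sum>w | length w = n. \<Prod>i\<leftarrow>w. lam i / (mu Server1 + mu Server2))
      = ((lam Type1 + lam Type2) / (mu Server1 + mu Server2)) ^ n" for n
  proof (induction n)
    case (Suc n)
    show ?case
      unfolding split list.map prod_list.Cons sum_distrib_left[symmetric] Suc
      by (simp add: add_divide_distrib distrib_right)
  qed simp
  then show ?case
    unfolding split red_weight.simps sum_distrib_left[symmetric] Suc by simp
qed simp

lemma length_weight_pos: "0 < length_weight n"
  by (induction n) (auto intro!: add_pos_pos mult_pos_pos divide_pos_pos zero_less_power simp del: mult_pos_pos)

text \<open>With \<open>r = \<lambda>\<^sub>2/\<mu>\<^sub>2\<close> and
  \<open>t = (\<lambda>\<^sub>1 + \<lambda>\<^sub>2)/\<mu>\<close>, the defining recurrence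
  multiplies by \<open>r\<close> and adds a multiple of a power of \<open>t\<close>; here the roles
  are swapped. This gives the sign of \<open>h (n + 1) - t * h n\<close> and expresses powers of
  \<open>r\<close> through \<open>h\<close>.\<close>

lemma length_weight_diff:
  "length_weight (Suc n) = (lam Type1 + lam Type2) / (mu Server1 + mu Server2) * length_weight n
    + mu Server1 / (mu Server1 + mu Server2) * (lam Type2 / mu Server2) ^ Suc n"
proof (induction n)
  case 0
  define r where "r = lam Type2 / mu Server2"
  have "r = (mu Server2 * r + mu Server1 * r) / (mu Server1 + mu Server2)"
    by (simp add: add.commute flip: distrib_right)
  also have "\<dots> = lam Type2 / (mu Server1 + mu Server2) + mu Server1 / (mu Server1 + mu Server2) * r"
    by (simp add: add_divide_distrib) (simp add: r_def)
  finally have "r + lam Type1 / (mu Server1 + mu Server2)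
      = (lam Type1 + lam Type2) / (mu Server1 + mu Server2) + mu Server1 / (mu Server1 + mu Server2) * r"
    unfolding add_divide_distrib by linarith
  then show ?case
    by (simp add: r_def)
next
  case (Suc n)
  define r where "r = lam Type2 / mu Server2"
  define t where "t = (lam Type1 + lam Type2) / (mu Server1 + mu Server2)"
  define a where "a = lam Type1 / (mu Server1 + mu Server2)"
  define b where "b = mu Server1 / (mu Server1 + mu Server2)"
  have rec: "length_weight (Suc n) = r * length_weight n + a * t ^ n" for n
    by (simp add: r_def t_def a_def)
  have IH: "length_weight (Suc n) = t * length_weight n + b * r ^ Suc n"
    using Suc by (simp add: r_def t_def b_def)
  have "length_weight (Suc (Suc n)) = r * (t * length_weight n + b * r ^ Suc n) + a * t ^ Suc n"
    using rec[of "Suc n"] IH by simp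
  also have "\<dots> = t * (r * length_weight n + a * t ^ n) + b * r ^ Suc (Suc n)"
    by (simp add: algebra_simps)
  finally show ?case
    using rec[of n] by (simp add: r_def t_def b_def)
qed

text \<open>By the defining recurrence, the difference of the two sides is
  \<open>a * t ^ n * (h (n + 1) - t * h n)\<close>, and the bracket is positive by
  \<open>length_weight_diff\<close>.\<close>

lemma length_weight_log_concave:
  "length_weight n * length_weight (Suc (Suc n)) \<le> (length_weight (Suc n))\<^sup>2"
proof -
  define r where "r = lam Type2 / mu Server2"
  define t where "t = (lam Type1 + lam Type2) / (mu Server1 + mu Server2)"
  define a where "a = lam Type1 / (mu Server1 + mu Server2)"
  have rec: "length_weight (Suc n) = r * length_weight n + a * t ^ n" for n
    by (simp add: r_def t_def a_def)
  have nonneg: "0 \<le> a" "0 \<le> t"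
    unfolding a_def t_def by (auto intro!: divide_nonneg_pos less_imp_le[OF pos(1)] less_imp_le[OF pos(5)])
  have "0 \<le> length_weight (Suc n) - t * length_weight n"
    unfolding length_weight_diff t_def by (simp add: less_imp_le)
  then have "0 \<le> a * t ^ n * (length_weight (Suc n) - t * length_weight n)"
    using nonneg by simp
  also have "\<dots> = length_weight (Suc n) * (r * length_weight n + a * t ^ n)
      - length_weight n * (r * length_weight (Suc n) + a * t ^ Suc n)"
    by (simp add: algebra_simps del: length_weight.simps)
  also have "\<dots> = (length_weight (Suc n))\<^sup>2 - length_weight n * length_weight (Suc (Suc n))"
    by (simp only: rec[symmetric] power2_eq_square)
  finally show ?thesis by simp
qed

text \<open>Index \<open>n\<close> stands for \<open>n + 1\<close> customers, that is, for the value
  \<open>n\<close> of \<open>N\<^sup>q - 1\<close>; the empty states are left out.\<close>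

fun fcfs_weight :: "nat \<Rightarrow> real" where
  "fcfs_weight 0 = mu Server2 / (lam Type1 + lam Type2) + mu Server1 / lam Type1"
| "fcfs_weight (Suc n) = mu Server1 / lam Type1 * (lam Type2 / mu Server2) ^ Suc n + length_weight n"

lemma sum_lumped_weight:
  "finite {x. lumped_number x = Suc n}"
  "(\<Sum>x | lumped_number x = Suc n. lumped_weight x) = fcfs_weight n"
proof -
  have "lumped_number x = Suc n \<longleftrightarrow>
      x \<in> Both ` {w. Suc (length w) = n} \<union> (if n = 0 then {Only1, Only2 0} else {Only2 n})" for x
    by (cases x) auto
  then have eq: "{x. lumped_number x = Suc n} =
      Both ` {w. Suc (length w) = n} \<union> (if n = 0 then {Only1, Only2 0} else {Only2 n})"
    by blast
  have fin: "finite {w :: ctype list. Suc (length w) = n}"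
    using finite_lists_length_eq[of "UNIV :: ctype set" "n - 1"] by (cases n) auto
  show "finite {x. lumped_number x = Suc n}"
    unfolding eq using fin by simp
  show "(\<Sum>x | lumped_number x = Suc n. lumped_weight x) = fcfs_weight n"
    unfolding eq using fin by (subst sum_Both_Un) (auto simp: sum_red_weight gr0_conv_Suc)
qed

lemma fcfs_weight_0: "fcfs_weight 0 = (mu Server1 + mu Server2) / lam Type1 * length_weight 0
    - lam Type2 / lam Type1 * (mu Server2 / (lam Type1 + lam Type2))"
proof -
  have "mu Server2 / lam Type1 = (lam Type1 + lam Type2) * mu Server2 / (lam Type1 * (lam Type1 + lam Type2))"
    by simp
  also have "\<dots> = mu Server2 / (lam Type1 + lam Type2)
      + lam Type2 / lam Type1 * (mu Server2 / (lam Type1 + lam Type2))"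
    unfolding distrib_right add_divide_distrib by simp
  finally show ?thesis
    by (simp add: add_divide_distrib)
qed

text \<open>The power coming from \<open>Only2\<close> is eliminated by
  \<open>length_weight_diff\<close>.\<close>

lemma fcfs_weight_Suc:
  "fcfs_weight (Suc n) = (mu Server1 + mu Server2) / lam Type1 * length_weight (Suc n)
    - lam Type2 / lam Type1 * length_weight n"
proof -
  have "(mu Server1 + mu Server2) / lam Type1 * length_weight (Suc n)
      = (lam Type1 + lam Type2) / lam Type1 * length_weight n
        + mu Server1 / lam Type1 * (lam Type2 / mu Server2) ^ Suc n"
    unfolding length_weight_diff distrib_left by simp
  then show ?thesis
    by (simp add: add_divide_distrib distrib_right)
qed

text \<open>The ratio is \<open>\<mu>/\<lambda>\<^sub>1 - \<lambda>\<^sub>2/\<lambda>\<^sub>1 * h (n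
  - 1) / h n\<close>, and log-concavity makes \<open>h (n - 1) / h n\<close> increase.\<close>

lemma likelihood_ratio_antimono:
  assumes "m \<le> n"
  shows "fcfs_weight n / length_weight n \<le> fcfs_weight m / length_weight m"
proof -
  have "decseq (\<lambda>n. fcfs_weight n / length_weight n)"
  proof (rule decseq_SucI)
    fix n
    \<comment> \<open>With this value at \<open>n - 1 = -1\<close>, one formula covers \<open>fcfs_weight\<close> at 0 and at \<open>Suc n\<close>.\<close>
    define h where "h = (case n of 0 \<Rightarrow> mu Server2 / (lam Type1 + lam Type2) | Suc k \<Rightarrow> length_weight k)"
    have eq: "fcfs_weight n = (mu Server1 + mu Server2) / lam Type1 * length_weight n
        - lam Type2 / lam Type1 * h"
      unfolding h_def using fcfs_weight_0 fcfs_weight_Suc by (cases n) (simp_all only: nat.case)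
    have "h * length_weight (Suc n) \<le> (length_weight n)\<^sup>2"
    proof (cases n)
      case 0
      \<comment> \<open>Log-concavity at the boundary, \<open>h (-1) * h 1 \<le> 1\<close>, amounts
        to \<open>h 1 \<le> (\<lambda>\<^sub>1 + \<lambda>\<^sub>2)/\<mu>\<^sub>2\<close>.\<close>
      have "lam Type1 / (mu Server1 + mu Server2) \<le> lam Type1 / mu Server2"
        by (intro divide_left_mono) (simp_all add: less_imp_le)
      then have "length_weight 1 \<le> (lam Type1 + lam Type2) / mu Server2"
        by (simp add: add_divide_distrib)
      then have "mu Server2 / (lam Type1 + lam Type2) * length_weight 1
          \<le> mu Server2 / (lam Type1 + lam Type2) * ((lam Type1 + lam Type2) / mu Server2)"
        by (intro mult_left_mono) (simp_all add: less_imp_le)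
      with 0 show ?thesis
        by (simp add: h_def)
    next
      case (Suc k)
      then show ?thesis
        using length_weight_log_concave[of k] by (simp add: h_def del: length_weight.simps)
    qed
    then have "0 \<le> lam Type2 / lam Type1 * ((length_weight n)\<^sup>2 - h * length_weight (Suc n))"
      by (simp add: less_imp_le)
    also have "\<dots> = fcfs_weight n * length_weight (Suc n) - fcfs_weight (Suc n) * length_weight n"
      unfolding eq fcfs_weight_Suc by (simp add: algebra_simps power2_eq_square del: length_weight.simps)
    finally show "fcfs_weight (Suc n) / length_weight (Suc n) \<le> fcfs_weight n / length_weight n"
      using length_weight_pos[of n] length_weight_pos[of "Suc n"]
      by (simp add: divide_le_eq pos_le_divide_eq mult.commute del: length_weight.simps fcfs_weight.simps)
  qed
  then show ?thesis
    using assms by (simp add: decseq_def)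
qed

text \<open>Compares \<open>N\<^sup>q\<close> with \<open>N\<^sup>r + 1\<close>, so that both laws
  live on the natural numbers.\<close>

lemma number_tail_le:
  assumes "red_steady_state lam mu pr" and "fcfs_steady_state lam mu pq"
  shows "measure_pmf.prob (map_pmf (\<lambda>s. lumped_number (lump s)) pq) {k..}
    \<le> measure_pmf.prob (map_pmf (\<lambda>w. Suc (length w)) pr) {k..}"
proof (rule likelihood_ratio_imp_tail_le)
  let ?X = "map_pmf (\<lambda>w. Suc (length w)) pr" and ?Y = "map_pmf (\<lambda>s. lumped_number (lump s)) pq"
  obtain c where c: "0 \<le> c" "\<And>w. pmf pr w = c * red_weight w"
    using red_steady_state_weight[OF assms(1)] by blast
  obtain d where d: "0 \<le> d" "\<And>x. pmf (map_pmf lump pq) x = d * lumped_weight x"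
    using fcfs_steady_state_weight[OF assms(2)] by blast
  \<comment> \<open>Makes the ratio condition trivial at \<open>m = 0\<close>, so the weights of the
    empty FCFS-ALIS states never enter.\<close>
  have X0: "pmf ?X 0 = 0"
    by (simp add: pmf_map vimage_def)
  have X: "pmf ?X (Suc n) = c * length_weight n" for n
  proof -
    have "finite {w :: ctype list. length w = n}"
      using finite_lists_length_eq[of "UNIV :: ctype set" n] by simp
    then show ?thesis
      by (simp add: pmf_map vimage_def measure_measure_pmf_finite c sum_red_weight flip: sum_distrib_left)
  qed
  have Y: "pmf ?Y (Suc n) = d * fcfs_weight n" for n
  proof -
    have "?Y = map_pmf lumped_number (map_pmf lump pq)"
      by (simp add: map_pmf_comp)
    then have "pmf ?Y (Suc n) = measure_pmf.prob (map_pmf lump pq) {x. lumped_number x = Suc n}"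
      by (simp only: pmf_map vimage_def) simp
    also have "\<dots> = d * fcfs_weight n"
      unfolding measure_measure_pmf_finite[OF sum_lumped_weight(1)] d
      by (simp add: sum_lumped_weight(2) flip: sum_distrib_left)
    finally show ?thesis .
  qed
  fix m n :: nat
  assume "m \<le> n"
  show "pmf ?Y n * pmf ?X m \<le> pmf ?Y m * pmf ?X n"
  proof (cases m)
    case 0
    then show ?thesis by (simp add: X0)
  next
    case (Suc m')
    with \<open>m \<le> n\<close> obtain n' where n: "n = Suc n'" "m' \<le> n'"
      by (cases n) auto
    have "fcfs_weight n' * length_weight m' \<le> fcfs_weight m' * length_weight n'"
      using likelihood_ratio_antimono[OF n(2)] length_weight_pos[of m'] length_weight_pos[of n']
      by (simp add: field_simps)
    then have "(d * c) * (fcfs_weight n' * length_weight m') \<le> (d * c) * (fcfs_weight m' * length_weight n')"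
      using c(1) d(1) by (intro mult_left_mono) auto
    then show ?thesis
      unfolding Suc n X Y by (simp add: mult_ac)
  qed
qed

end

theorem theorem4p1:
  fixes lam :: "ctype \<Rightarrow> real" and mu :: "server \<Rightarrow> real"
    and pr :: "ctype list pmf" and pq :: "fcfs_state pmf"
  assumes "lam Type1 > 0" and "lam Type2 > 0"
    and "mu Server1 > 0" and "mu Server2 > 0"
    and "lam Type2 < mu Server2"
    and "lam Type1 + lam Type2 < mu Server1 + mu Server2"
    and "red_steady_state lam mu pr"
    and "fcfs_steady_state lam mu pq"
  shows "map_pmf (\<lambda>s. real (red_number Type1 s) + real (red_number Type2 s)) pr
    \<ge>\<^sub>S\<^sub>T map_pmf (\<lambda>s. real (fcfs_number Type1 s) + real (fcfs_number Type2 s) - 1) pq"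
  unfolding st_ge_def
proof
  fix x :: real
  interpret n_system lam mu
  proof
    show "0 < lam i" for i
      using assms by (cases i) auto
    show "0 < mu j" for j
      using assms by (cases j) auto
  qed
  have red: "real (red_number Type1 w) + real (red_number Type2 w) = real (length w)" for w
    by (simp add: red_number_def flip: of_nat_add count_list_ctype)
  have fcfs: "map_pmf (\<lambda>s. real (fcfs_number Type1 s) + real (fcfs_number Type2 s) - 1) pq
      = map_pmf (\<lambda>s. real (lumped_number (lump s)) - 1) pq"
    using lumped_number_lump[OF fcfs_steady_state_valid[OF assms(8)]]
    by (intro map_pmf_cong) (simp_all flip: of_nat_add)
  \<comment> \<open>Replaces the real threshold by a natural one for the numbers raised by 1. For
    \<open>x < -1\<close> the truncation by \<open>nat\<close> is harmless, as both events are
    certain.\<close>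
  have "{w :: ctype list. x \<le> real (length w)} = {w. nat \<lceil>x + 1\<rceil> \<le> Suc (length w)}"
    unfolding nat_ceiling_le_eq by auto
  moreover have "{s. x \<le> real (lumped_number (lump s)) - 1} = {s. nat \<lceil>x + 1\<rceil> \<le> lumped_number (lump s)}"
    unfolding nat_ceiling_le_eq by auto
  ultimately show "measure_pmf.prob (map_pmf (\<lambda>s. real (fcfs_number Type1 s) + real (fcfs_number Type2 s) - 1) pq) {x..}
      \<le> measure_pmf.prob (map_pmf (\<lambda>s. real (red_number Type1 s) + real (red_number Type2 s)) pr) {x..}"
    using number_tail_le[OF assms(7,8), of "nat \<lceil>x + 1\<rceil>"]
    unfolding fcfs red by (simp add: vimage_def)
qed

end
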